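(* Let $\mathcal{S}$ be a commutative algebra with $n$ commuting derivations $D_1,\dots,D_n$, let $F_1,\dots,F_n\in\mathcal{S}$, and let the elements $A_{s_1,\dots,s_n,l}$ be defined by the initial conditions $A_{0,\dots,0,0}=1$ and $A_{s_1,\dots,s_n,0}=0$ when at least one $s_i\neq0$, and by the recursion $$A_{s_1,\dots,s_n,l+1}=\sum_{i=1}^nF_i\cdot\bigl(D_i(A_{s_1,\dots,s_n,l})+A_{s_1,\dots,s_{i-1},s_i-1,s_{i+1},\dots,s_n,l}\bigr),$$ with $A_{s_1,\dots,s_n,l}=0$ if some $s_i<0$. Then for all $s_{ij}$, where $1\leq i\leq n$, $1\leq j\leq k$, and $s_i=\sum_{j=1}^ks_{ij}$, $$\frac{s_1!\cdots s_n!}{s_{11}!\,s_{12}!\cdots s_{nk}!}\,A_{s_1,\dots,s_n,l}=\sum_{\substack{l_1+\dots+l_k=l\\ l\geq l_j\geq1}}\frac{l!}{l_1!\cdots l_k!}\,A_{s_{11},\dots,s_{n1},l_1}\cdots A_{s_{1k},\dots,s_{nk},l_k}.$$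
   Context: A derivation of $\mathcal{S}$ is an additive map $D$ with $D(ab)=D(a)b+aD(b)$. No assumption is made on the characteristic. The $s_{ij}$ and $l$ are nonnegative integers. The denominator on the left is the product of all $s_{ij}!$ with $1\le i\le n$, $1\le j\le k$. The sum on the right runs over all $k$-tuples of integers $(l_1,\dots,l_k)$ satisfying the indicated conditions.
   Formalization: The printed identity fails when some column (s_1j,…,s_nj) is zero (n=1, k=2, s=(1,0), l=1 gives F_1=0); it is proved when no column is zero, and for all s_ij with the sum over l ≥ l_j ≥ 0 instead of l_j ≥ 1. *)

theory Defs
  imports Complex_Main "HOL-Library.FuncSet"
begin

definition derivation :: "('a::comm_ring_1 \<Rightarrow> 'a) \<Rightarrow> bool" where
  "derivation D \<longleftrightarrow> Modules.additive D \<and> (\<forall>a b. D (a * b) = D a * b + a * D b)"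

(* Multi-indices are integer valued, so that the shift s_i - 1 is not truncated.
   Only the values s i, D i, F i with 1 <= i <= n matter. *)
primrec coeffA ::
  "nat \<Rightarrow> (nat \<Rightarrow> 'a::comm_ring_1 \<Rightarrow> 'a) \<Rightarrow> (nat \<Rightarrow> 'a) \<Rightarrow> (nat \<Rightarrow> int) \<Rightarrow> nat \<Rightarrow> 'a" where
  "coeffA n D F s 0 = (if \<forall>i\<in>{1..n}. s i = 0 then 1 else 0)"
| "coeffA n D F s (Suc l) =
     (if \<exists>i\<in>{1..n}. s i < 0 then 0
      else \<Sum>i\<in>{1..n}. F i * (D i (coeffA n D F s l) + coeffA n D F (s(i := s i - 1)) l))"

(* Both coefficients are products of multinomial coefficients: the divisions in nat are exact,
   and the results make sense in a ring of any characteristic. *)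
definition index_coeff :: "nat \<Rightarrow> nat \<Rightarrow> (nat \<Rightarrow> nat \<Rightarrow> nat) \<Rightarrow> nat" where
  "index_coeff n k s =
     (\<Prod>i\<in>{1..n}. fact (\<Sum>j\<in>{1..k}. s i j)) div (\<Prod>i\<in>{1..n}. \<Prod>j\<in>{1..k}. fact (s i j))"

definition multinom :: "nat \<Rightarrow> nat \<Rightarrow> (nat \<Rightarrow> nat) \<Rightarrow> nat" where
  "multinom k l ls = fact l div (\<Prod>j\<in>{1..k}. fact (ls j))"

(* The k-tuples with sum l and entries between m and l.  With m = 1 the identity can fail when
   some column (s 1 j, ..., s n j) vanishes: A_(0,...,0,l) is 0 for l >= 1 but 1 for l = 0, so the
   needed terms with l_j = 0 are then missing (n = 1, k = 2, s = (1, 0), l = 1 would give F_1 = 0).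
   With m = 0 it holds without restriction, and if no column vanishes the additional terms
   are 0. *)
definition tuples :: "nat \<Rightarrow> nat \<Rightarrow> nat \<Rightarrow> (nat \<Rightarrow> nat) set" where
  "tuples m k l = {ls \<in> {1..k} \<rightarrow>\<^sub>E {m..l}. (\<Sum>j\<in>{1..k}. ls j) = l}"

end

(* A_(s,l) is the coefficient of x^s in (sum_i F_i (D_i + x_i))^l applied to 1.  The operator
   for x + y acts on a product P(x) Q(y) by the Leibniz rule, so its l-th power applied to 1 * 1
   expands binomially; comparing coefficients of x^s y^t gives the identity for k = 2, and the
   general case follows by induction on k. *)
theory Submission
  imports Defs
begin

section \<open>Derivations and degenerate multi-indices\<close>

lemma derivation_of_nat_mult:
  assumes "derivation D"
  shows "D (of_nat k * x) = of_nat k * D x"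
proof -
  have add: "Modules.additive D"
    using assms by (auto simp: derivation_def)
  show ?thesis
    by (induction k) (simp_all add: additive.zero[OF add] additive.add[OF add] distrib_right)
qed

text \<open>Puts the Leibniz rule in the shape of the right-hand side of the two-block identity,
  where the binomial coefficients act as constants.\<close>

lemma derivation_sum_of_nat_mult:
  assumes "derivation D"
  shows "D (\<Sum>m\<in>M. of_nat (c m) * (a m * b m)) =
    (\<Sum>m\<in>M. of_nat (c m) * (D (a m) * b m + a m * D (b m)))"
proof -
  have add: "Modules.additive D" and mult: "D (x * y) = D x * y + x * D y" for x y
    using assms by (auto simp: derivation_def)
  show ?thesis
    by (simp only: additive.sum[OF add] derivation_of_nat_mult[OF assms]) (simp only: mult)
qed

lemma derivation_0: "derivation D \<Longrightarrow> D 0 = 0"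
  using derivation_of_nat_mult[of D 0] by simp

text \<open>The Leibniz rule for \<open>1 * 1\<close> gives \<open>D 1 = D 1 + D 1\<close>.\<close>

lemma derivation_1: "derivation D \<Longrightarrow> D 1 = 0"
  unfolding derivation_def by (metis add_cancel_right_left mult_1 mult.right_neutral)

lemma coeffA_negative:
  assumes "i \<in> {1..n}" "s i < 0"
  shows "coeffA n D F s l = 0"
  using assms by (cases l) force+

text \<open>In the recursion every shift makes an index negative and every \<open>D i\<close> kills
  the constants 0 and 1, so nothing survives beyond \<open>l = 0\<close>.\<close>

lemma coeffA_zero_index:
  assumes der: "\<forall>i\<in>{1..n}. derivation (D i)"
    and s: "\<And>i. i \<in> {1..n} \<Longrightarrow> s i = 0"
  shows "coeffA n D F s l = (if l = 0 then 1 else 0)"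
proof (induction l)
  case 0
  then show ?case using s by simp
next
  case (Suc l)
  have "coeffA n D F (s(i := s i - 1)) l = 0" if "i \<in> {1..n}" for i
    using that s by (intro coeffA_negative[of i]) auto
  then show ?case
    using Suc s der by (auto intro!: sum.neutral simp: derivation_0 derivation_1)
qed

section \<open>Binomial coefficients of integer multi-indices\<close>

text \<open>Setting the coefficient to 0 when an index is negative makes Pascal's rule and the two-block
  identity hold for all integer indices, as the shift \<open>s i - 1\<close> in the induction on \<open>l\<close> requires.\<close>

definition int_binomial :: "int \<Rightarrow> int \<Rightarrow> nat" where
  "int_binomial a b = (if a < 0 \<or> b < 0 then 0 else nat (a + b) choose nat a)"

text \<open>The origin is excluded because the left side is 1 there and both right terms are 0.
  Elsewhere on a nonnegative axis one right term has an argument -1 and the other is 1.\<close>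

lemma int_binomial_Pascal:
  assumes "a \<noteq> 0 \<or> b \<noteq> 0"
  shows "int_binomial a b = int_binomial (a - 1) b + int_binomial a (b - 1)"
proof (cases "a > 0 \<and> b > 0")
  case True
  define p q where "p = nat (a - 1)" and "q = nat (b - 1)"
  have "a = int (Suc p)" "b = int (Suc q)"
    using True by (auto simp: p_def q_def)
  then show ?thesis
    by (simp add: int_binomial_def nat_add_distrib)
next
  case False
  then consider "a < 0 \<or> b < 0" | "a = 0" "b > 0" | "a > 0" "b = 0"
    using assms by linarith
  then show ?thesis
    by cases (auto simp: int_binomial_def)
qed

text \<open>For nonnegative indices this is the coefficient of \<open>x^s y^t\<close> in
  \<open>(x + y)^(s + t)\<close>, in multi-index notation.\<close>

definition multi_binomial :: "nat \<Rightarrow> (nat \<Rightarrow> int) \<Rightarrow> (nat \<Rightarrow> int) \<Rightarrow> nat" where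
  "multi_binomial n s t = (\<Prod>i\<in>{1..n}. int_binomial (s i) (t i))"

lemma multi_binomial_negative:
  assumes "i \<in> {1..n}" "s i < 0 \<or> t i < 0"
  shows "multi_binomial n s t = 0"
  using assms unfolding multi_binomial_def
  by (intro prod_zero) (auto simp: int_binomial_def)

lemma multi_binomial_Pascal:
  assumes i: "i \<in> {1..n}" and nz: "s i \<noteq> 0 \<or> t i \<noteq> 0"
  shows "multi_binomial n s t =
    multi_binomial n (s(i := s i - 1)) t + multi_binomial n s (t(i := t i - 1))"
proof -
  \<comment> \<open>\<open>P\<close> collects the factors untouched by a shift at \<open>i\<close>,
    which reduces the claim to Pascal's rule in one coordinate.\<close>
  define P where "P = (\<Prod>j\<in>{1..n} - {i}. int_binomial (s j) (t j))"
  have split: "multi_binomial n s' t' = int_binomial (s' i) (t' i) * P"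
    if "\<And>j. j \<noteq> i \<Longrightarrow> s' j = s j" "\<And>j. j \<noteq> i \<Longrightarrow> t' j = t j" for s' t'
    unfolding multi_binomial_def P_def using that i
    by (subst prod.remove[of _ i]) (auto intro!: prod.cong)
  show ?thesis
    using int_binomial_Pascal[OF nz]
    by (simp add: split distrib_right)
qed

section \<open>The identity for two blocks\<close>

text \<open>The induction step of the binomial theorem for two commuting operations, one advancing
  the index of \<open>f\<close> and one that of \<open>g\<close>.\<close>

lemma sum_binomial_Suc:
  fixes f g :: "nat \<Rightarrow> 'a::comm_ring_1"
  shows "(\<Sum>m\<le>l. of_nat (l choose m) * (f (Suc m) * g (l - m) + f m * g (Suc (l - m)))) =
    (\<Sum>m\<le>Suc l. of_nat (Suc l choose m) * (f m * g (Suc l - m)))"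
proof -
  \<comment> \<open>The range can be extended to \<open>Suc l\<close> because
    \<open>l choose Suc l\<close> is 0.\<close>
  have "(\<Sum>m\<le>l. of_nat (l choose m) * (f m * g (Suc (l - m)))) =
      (\<Sum>m\<le>Suc l. of_nat (l choose m) * (f m * g (Suc l - m)))"
    by (simp add: Suc_diff_le binomial_eq_0)
  also have "\<dots> = f 0 * g (Suc l) + (\<Sum>m\<le>l. of_nat (l choose Suc m) * (f (Suc m) * g (l - m)))"
    by (subst sum.atMost_Suc_shift) simp
  finally have shifted: "(\<Sum>m\<le>l. of_nat (l choose m) * (f m * g (Suc (l - m)))) = \<dots>" .
  show ?thesis
    by (subst sum.atMost_Suc_shift)
      (simp add: shifted distrib_left distrib_right sum.distrib add_ac)
qed

text \<open>Under the recursion the derivative part splits by the Leibniz rule and the shift part by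
  Pascal's rule; each half advances one of the two factors. Both \<open>s\<close> and
  \<open>t\<close> vary in the induction because the shifts change them.\<close>

lemma coeffA_add:
  assumes der: "\<forall>i\<in>{1..n}. derivation (D i)"
  shows "of_nat (multi_binomial n s t) * coeffA n D F (\<lambda>i. s i + t i) l =
    (\<Sum>m\<le>l. of_nat (l choose m) * (coeffA n D F s m * coeffA n D F t (l - m)))"
proof (induction l arbitrary: s t)
  case 0
  show ?case
  \<comment> \<open>With a negative entry both sides vanish: the left through
    \<open>multi_binomial\<close>, even if \<open>s i + t i\<close> is nonnegative, and the right
    through one factor of the product.\<close>
  proof (cases "\<exists>i\<in>{1..n}. s i < 0 \<or> t i < 0")
    case True
    then obtain i where "i \<in> {1..n}" "s i < 0 \<or> t i < 0" by blast
    then have "coeffA n D F s 0 * coeffA n D F t 0 = 0"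
      by (auto simp: coeffA_negative simp del: coeffA.simps)
    then show ?thesis
      using multi_binomial_negative[of i n s t] \<open>i \<in> {1..n}\<close> \<open>s i < 0 \<or> t i < 0\<close>
      by (simp del: coeffA.simps)
  next
    case False
    \<comment> \<open>Entries that are all nonnegative cannot cancel in
      \<open>s i + t i\<close>.\<close>
    then have "(\<forall>i\<in>{1..n}. s i + t i = 0) \<longleftrightarrow> (\<forall>i\<in>{1..n}. s i = 0 \<and> t i = 0)"
      by force
    moreover have "multi_binomial n s t = 1" if "\<forall>i\<in>{1..n}. s i = 0 \<and> t i = 0"
      using that by (simp add: multi_binomial_def int_binomial_def)
    ultimately show ?thesis
      by (auto simp del: atLeastAtMost_iff)
  qed
next
  case (Suc l)
  let ?A = "coeffA n D F"
  let ?c = "multi_binomial n"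
  show ?case
  proof (cases "\<exists>i\<in>{1..n}. s i < 0 \<or> t i < 0")
    case True
    then obtain i where i: "i \<in> {1..n}" "s i < 0 \<or> t i < 0" by blast
    then have "?A s m * ?A t m' = 0" for m m'
      by (auto simp: coeffA_negative simp del: coeffA.simps)
    then show ?thesis
      using multi_binomial_negative[of i n s t] i by (simp del: coeffA.simps)
  next
    case False
    define r where "r = (\<lambda>i. s i + t i)"
    \<comment> \<open>Lowering \<open>r\<close> at \<open>i\<close> means lowering either
      \<open>s\<close> or \<open>t\<close> there; Pascal's rule divides the coefficient between the
      two, and the induction hypothesis applies to each.\<close>
    have shift: "of_nat (?c s t) * ?A (r(i := r i - 1)) l =
        (\<Sum>m\<le>l. of_nat (l choose m) *
          (?A (s(i := s i - 1)) m * ?A t (l - m) + ?A s m * ?A (t(i := t i - 1)) (l - m)))"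
      if i: "i \<in> {1..n}" for i
    proof -
      have "of_nat (?c s t) * ?A (r(i := r i - 1)) l =
          of_nat (?c (s(i := s i - 1)) t) * ?A (r(i := r i - 1)) l +
          of_nat (?c s (t(i := t i - 1))) * ?A (r(i := r i - 1)) l"
      \<comment> \<open>Pascal's rule fails when both entries are 0, but then \<open>r i - 1\<close>
        is negative and the \<open>coeffA\<close> factor vanishes.\<close>
      proof (cases "s i = 0 \<and> t i = 0")
        case True
        then have "?A (r(i := r i - 1)) l = 0"
          using i by (intro coeffA_negative[of i]) (auto simp: r_def)
        then show ?thesis by simp
      next
        case False
        then show ?thesis
          using multi_binomial_Pascal[OF i, of s t] by (simp add: distrib_right)
      qed
      moreover have "of_nat (?c (s(i := s i - 1)) t) * ?A (r(i := r i - 1)) l =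
          (\<Sum>m\<le>l. of_nat (l choose m) * (?A (s(i := s i - 1)) m * ?A t (l - m)))"
      proof -
        have eq: "r(i := r i - 1) = (\<lambda>j. (s(i := s i - 1)) j + t j)"
          by (auto simp: r_def)
        show ?thesis
          unfolding eq by (rule Suc.IH)
      qed
      moreover have "of_nat (?c s (t(i := t i - 1))) * ?A (r(i := r i - 1)) l =
          (\<Sum>m\<le>l. of_nat (l choose m) * (?A s m * ?A (t(i := t i - 1)) (l - m)))"
      proof -
        have eq: "r(i := r i - 1) = (\<lambda>j. s j + (t(i := t i - 1)) j)"
          by (auto simp: r_def)
        show ?thesis
          unfolding eq by (rule Suc.IH)
      qed
      ultimately show ?thesis
        by (simp only: distrib_left sum.distrib)
    qed
    have rec: "?A u (Suc m) = (\<Sum>i\<in>{1..n}. F i * (D i (?A u m) + ?A (u(i := u i - 1)) m))"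
      if "\<not> (\<exists>i\<in>{1..n}. u i < 0)" for u m
      using that by simp
    have rec_s: "?A s (Suc m) = (\<Sum>i\<in>{1..n}. F i * (D i (?A s m) + ?A (s(i := s i - 1)) m))"
      and rec_t: "?A t (Suc m) = (\<Sum>i\<in>{1..n}. F i * (D i (?A t m) + ?A (t(i := t i - 1)) m))"
      and rec_r: "?A r (Suc m) = (\<Sum>i\<in>{1..n}. F i * (D i (?A r m) + ?A (r(i := r i - 1)) m))" for m
      using False by (auto intro!: rec simp: r_def not_less)
    have IH: "of_nat (?c s t) * ?A r l =
        (\<Sum>m\<le>l. of_nat (l choose m) * (?A s m * ?A t (l - m)))"
      unfolding r_def by (rule Suc.IH)
    \<comment> \<open>The coefficient is a natural number, so it moves inside \<open>D i\<close>,
      where the induction hypothesis can be substituted.\<close>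
    have "of_nat (?c s t) * ?A r (Suc l) =
        (\<Sum>i\<in>{1..n}. F i * (D i (of_nat (?c s t) * ?A r l) +
          of_nat (?c s t) * ?A (r(i := r i - 1)) l))"
      unfolding rec_r sum_distrib_left
      by (intro sum.cong refl) (simp add: derivation_of_nat_mult[OF der[rule_format]] algebra_simps)
    \<comment> \<open>The four resulting terms are grouped by the factor they act on,
      \<open>s\<close> or \<open>t\<close>.\<close>
    also have "\<dots> = (\<Sum>i\<in>{1..n}. \<Sum>m\<le>l. of_nat (l choose m) *
        (F i * (D i (?A s m) + ?A (s(i := s i - 1)) m) * ?A t (l - m) +
         ?A s m * (F i * (D i (?A t (l - m)) + ?A (t(i := t i - 1)) (l - m)))))"
      unfolding IH
      by (intro sum.cong refl)
        (simp add: shift derivation_sum_of_nat_mult[OF der[rule_format]] sum_distrib_left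
          flip: sum.distrib, simp add: algebra_simps)
    \<comment> \<open>After the sums are exchanged, the inner sums over \<open>i\<close> are the
      recursions for \<open>s\<close> and \<open>t\<close>.\<close>
    also have "\<dots> = (\<Sum>m\<le>l. of_nat (l choose m) *
        (?A s (Suc m) * ?A t (l - m) + ?A s m * ?A t (Suc (l - m))))"
      unfolding rec_s rec_t
      by (subst sum.swap)
        (simp only: sum_distrib_left sum_distrib_right sum.distrib distrib_left distrib_right)
    also have "\<dots> = (\<Sum>m\<le>Suc l. of_nat (Suc l choose m) * (?A s m * ?A t (Suc l - m)))"
      by (rule sum_binomial_Suc)
    finally show ?thesis
      unfolding r_def .
  qed
qed

section \<open>Multinomial coefficients\<close>

lemma prod_fact_dvd_fact_sum:
  fixes f :: "'b \<Rightarrow> nat"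
  assumes "finite J"
  shows "(\<Prod>j\<in>J. fact (f j)) dvd (fact (\<Sum>j\<in>J. f j) :: nat)"
  using assms
proof (induction J)
  case empty
  then show ?case by simp
next
  case (insert x J)
  have "fact (f x) * (\<Prod>j\<in>J. fact (f j)) dvd fact (f x) * (fact (\<Sum>j\<in>J. f j) :: nat)"
    using insert.IH by (rule mult_dvd_mono[OF dvd_refl])
  also have "\<dots> dvd fact (f x + (\<Sum>j\<in>J. f j))"
    by (rule fact_fact_dvd_fact)
  finally show ?case
    using insert.hyps by simp
qed

text \<open>In each row, splitting off the last block leaves a shorter multinomial coefficient times
  a binomial one.\<close>

lemma index_coeff_Suc:
  "index_coeff n (Suc k) s = index_coeff n k s *
    multi_binomial n (\<lambda>i. int (\<Sum>j\<in>{1..k}. s i j)) (\<lambda>i. int (s i (Suc k)))"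
proof -
  define N P Q B :: nat where
    "N = (\<Prod>i\<in>{1..n}. \<Prod>j\<in>{1..k}. fact (s i j))" and
    "P = (\<Prod>i\<in>{1..n}. fact (\<Sum>j\<in>{1..k}. s i j))" and
    "Q = (\<Prod>i\<in>{1..n}. fact (s i (Suc k)))" and
    "B = (\<Prod>i\<in>{1..n}. (\<Sum>j\<in>{1..Suc k}. s i j) choose (\<Sum>j\<in>{1..k}. s i j))"
  \<comment> \<open>Exactness of this division allows \<open>B\<close> to be pulled out of
    \<open>div\<close> below.\<close>
  have "N dvd P"
    unfolding N_def P_def by (intro prod_dvd_prod prod_fact_dvd_fact_sum) simp
  have "fact (a + b) = (a + b choose a) * fact a * (fact b :: nat)" for a b
    using binomial_fact_lemma[of a "a + b"] by (simp add: mult_ac)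
  then have "(\<Prod>i\<in>{1..n}. fact (\<Sum>j\<in>{1..Suc k}. s i j)) = B * P * Q"
    by (simp add: B_def P_def Q_def flip: prod.distrib)
  moreover have "(\<Prod>i\<in>{1..n}. \<Prod>j\<in>{1..Suc k}. fact (s i j)) = N * Q"
    by (simp add: N_def Q_def prod.distrib)
  ultimately have "index_coeff n (Suc k) s = (B * P * Q) div (N * Q)"
    unfolding index_coeff_def by simp
  also have "\<dots> = P div N * B"
    using \<open>N dvd P\<close> by (simp add: Q_def div_mult_swap mult.commute)
  also have "B = multi_binomial n (\<lambda>i. int (\<Sum>j\<in>{1..k}. s i j)) (\<lambda>i. int (s i (Suc k)))"
    by (simp add: B_def multi_binomial_def int_binomial_def nat_add_distrib
        del: of_nat_sum)
  finally show ?thesis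
    by (simp add: index_coeff_def N_def P_def)
qed

text \<open>Reading the tuple as a single row makes the block-splitting rule available for
  \<open>multinom\<close>.\<close>

lemma multinom_eq_index_coeff:
  assumes "(\<Sum>j\<in>{1..k}. ls j) = l"
  shows "multinom k l ls = index_coeff 1 k (\<lambda>_. ls)"
  using assms by (simp add: multinom_def index_coeff_def)

lemma multinom_Suc:
  assumes "(\<Sum>j\<in>{1..k}. ls j) = m" "m \<le> l"
  shows "multinom (Suc k) l (ls(Suc k := l - m)) = multinom k m ls * (l choose m)"
proof -
  have sum: "(\<Sum>j\<in>{1..k}. (ls(Suc k := l - m)) j) = m"
    using assms(1) by (auto intro: sum.cong)
  have "index_coeff 1 k (\<lambda>_. ls(Suc k := l - m)) = multinom k m ls"
    unfolding multinom_eq_index_coeff[OF sum, symmetric]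
    unfolding multinom_def by (intro arg_cong2[of _ _ _ _ "(div)"] prod.cong) auto
  moreover have "nat (int m + int (l - m)) = l"
    using assms(2) by simp
  ultimately show ?thesis
    using sum assms(2)
    by (simp add: multinom_eq_index_coeff[of _ "Suc k" l] index_coeff_Suc
        multi_binomial_def int_binomial_def del: of_nat_sum)
qed

section \<open>Tuples with prescribed sum\<close>

text \<open>The upper bound is automatic, since no entry exceeds the sum of all of them.\<close>

lemma tuples_0_eq: "tuples 0 k l = {ls \<in> extensional {1..k}. (\<Sum>j\<in>{1..k}. ls j) = l}"
proof -
  have "ls j \<le> (\<Sum>j\<in>{1..k}. ls j)" if "j \<in> {1..k}" for ls :: "nat \<Rightarrow> nat" and j
    using that by (intro member_le_sum) auto
  then show ?thesis
    by (auto simp: tuples_def PiE_def)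
qed

lemma finite_tuples: "finite (tuples m k l)"
proof -
  have "finite ({1..k} \<rightarrow>\<^sub>E {m..l})"
    by (simp add: finite_PiE)
  then show ?thesis
    by (rule rev_finite_subset) (auto simp: tuples_def)
qed

text \<open>Tuples are sorted by the sum \<open>m\<close> of their first \<open>k\<close> entries,
  which forces the last entry to be \<open>l - m\<close>.\<close>

lemma sum_tuples_Suc:
  "(\<Sum>ls\<in>tuples 0 (Suc k) l. g ls) =
    (\<Sum>m\<le>l. \<Sum>ls\<in>tuples 0 k m. g (ls(Suc k := l - m)))"
proof -
  have "(\<Sum>m\<le>l. \<Sum>ls\<in>tuples 0 k m. g (ls(Suc k := l - m))) =
      (\<Sum>(m, ls)\<in>Sigma {..l} (tuples 0 k). g (ls(Suc k := l - m)))"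
    by (simp add: sum.Sigma finite_tuples)
  also have "\<dots> = (\<Sum>ls\<in>tuples 0 (Suc k) l. g ls)"
  proof (rule sum.reindex_bij_witness[where
        i = "\<lambda>ls. (\<Sum>j\<in>{1..k}. ls j, ls(Suc k := undefined))" and
        j = "\<lambda>(m, ls). ls(Suc k := l - m)"])
    fix p assume "p \<in> Sigma {..l} (tuples 0 k)"
    then obtain m ls where p: "p = (m, ls)" "m \<le> l" "ls \<in> extensional {1..k}"
      "(\<Sum>j\<in>{1..k}. ls j) = m"
      by (auto simp: tuples_0_eq)
    have sum: "(\<Sum>j\<in>{1..k}. (ls(Suc k := l - m)) j) = m"
      using p(4) by (auto intro: sum.cong)
    \<comment> \<open>Extensionality makes resetting the last entry to \<open>undefined\<close> an
      exact inverse of appending it.\<close>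
    have "ls (Suc k) = undefined"
      using p(3) by (simp add: extensional_def)
    then show "(\<Sum>j\<in>{1..k}. (case p of (m, ls) \<Rightarrow> ls(Suc k := l - m)) j,
        (case p of (m, ls) \<Rightarrow> ls(Suc k := l - m))(Suc k := undefined)) = p"
      using p(1) sum by auto
    show "(case p of (m, ls) \<Rightarrow> ls(Suc k := l - m)) \<in> tuples 0 (Suc k) l"
      using p sum by (auto simp: tuples_0_eq extensional_def)
    show "g (case p of (m, ls) \<Rightarrow> ls(Suc k := l - m)) = (case p of (m, ls) \<Rightarrow> g (ls(Suc k := l - m)))"
      by (simp add: p(1))
  next
    fix ls assume "ls \<in> tuples 0 (Suc k) l"
    then have ls: "ls \<in> extensional {1..Suc k}" "(\<Sum>j\<in>{1..k}. ls j) + ls (Suc k) = l"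
      by (auto simp: tuples_0_eq)
    show "(case (\<Sum>j\<in>{1..k}. ls j, ls(Suc k := undefined)) of
        (m, ls) \<Rightarrow> ls(Suc k := l - m)) = ls"
      using ls(2) by auto
    have "(\<Sum>j\<in>{1..k}. (ls(Suc k := undefined)) j) = (\<Sum>j\<in>{1..k}. ls j)"
      by (auto intro: sum.cong)
    then show "(\<Sum>j\<in>{1..k}. ls j, ls(Suc k := undefined)) \<in> Sigma {..l} (tuples 0 k)"
      using ls by (auto simp: tuples_0_eq extensional_def)
  qed
  finally show ?thesis by simp
qed

section \<open>Induction on the number of blocks\<close>

text \<open>The first \<open>k\<close> blocks are merged into one, the two-block identity separates
  the last, and the induction hypothesis expands the merged block at every level \<open>m\<close> up
  to \<open>l\<close>.\<close>

lemma coeffA_sum: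
  assumes der: "\<forall>i\<in>{1..n}. derivation (D i)"
  shows "of_nat (index_coeff n k s) * coeffA n D F (\<lambda>i. int (\<Sum>j\<in>{1..k}. s i j)) l =
    (\<Sum>ls\<in>tuples 0 k l. of_nat (multinom k l ls) *
      (\<Prod>j\<in>{1..k}. coeffA n D F (\<lambda>i. int (s i j)) (ls j)))"
proof (induction k arbitrary: l)
  case 0
  \<comment> \<open>The empty tuple has sum 0, so the right side is 1 for \<open>l = 0\<close> and 0
    otherwise, as is \<open>coeffA\<close> at the zero index.\<close>
  have "tuples 0 0 l = (if l = 0 then {\<lambda>_. undefined} else {})"
    by (auto simp: tuples_0_eq)
  then show ?case
    using coeffA_zero_index[of n D "\<lambda>_. 0" F l, OF der]
    by (simp add: index_coeff_def multinom_def)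
next
  case (Suc k)
  let ?A = "coeffA n D F"
  let ?r = "\<lambda>i. int (\<Sum>j\<in>{1..k}. s i j)"
  let ?t = "\<lambda>j i. int (s i j)"
  have "of_nat (index_coeff n (Suc k) s) * ?A (\<lambda>i. int (\<Sum>j\<in>{1..Suc k}. s i j)) l =
      of_nat (index_coeff n k s) * (of_nat (multi_binomial n ?r (?t (Suc k))) *
        ?A (\<lambda>i. ?r i + ?t (Suc k) i) l)"
    by (simp add: index_coeff_Suc mult.assoc del: of_nat_sum)
  also have "\<dots> = (\<Sum>m\<le>l. of_nat (l choose m) *
      ((of_nat (index_coeff n k s) * ?A ?r m) * ?A (?t (Suc k)) (l - m)))"
    unfolding coeffA_add[OF der] sum_distrib_left by (simp only: mult_ac)
  also have "\<dots> = (\<Sum>m\<le>l. \<Sum>ls\<in>tuples 0 k m. of_nat (multinom k m ls * (l choose m)) *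
      ((\<Prod>j\<in>{1..k}. ?A (?t j) (ls j)) * ?A (?t (Suc k)) (l - m)))"
    unfolding Suc.IH sum_distrib_left sum_distrib_right by (simp only: mult_ac of_nat_mult)
  also have "\<dots> = (\<Sum>m\<le>l. \<Sum>ls\<in>tuples 0 k m.
      of_nat (multinom (Suc k) l (ls(Suc k := l - m))) *
      (\<Prod>j\<in>{1..Suc k}. ?A (?t j) ((ls(Suc k := l - m)) j)))"
  proof (intro sum.cong refl)
    fix m ls assume "m \<in> {..l}" "ls \<in> tuples 0 k m"
    then have "multinom (Suc k) l (ls(Suc k := l - m)) = multinom k m ls * (l choose m)"
      by (intro multinom_Suc) (auto simp: tuples_0_eq)
    moreover have "(\<Prod>j\<in>{1..Suc k}. ?A (?t j) ((ls(Suc k := l - m)) j)) =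
        (\<Prod>j\<in>{1..k}. ?A (?t j) (ls j)) * ?A (?t (Suc k)) (l - m)"
      by (auto intro!: arg_cong2[of _ _ _ _ "(*)"] prod.cong)
    ultimately show "of_nat (multinom k m ls * (l choose m)) *
        ((\<Prod>j\<in>{1..k}. ?A (?t j) (ls j)) * ?A (?t (Suc k)) (l - m)) =
      of_nat (multinom (Suc k) l (ls(Suc k := l - m))) *
        (\<Prod>j\<in>{1..Suc k}. ?A (?t j) ((ls(Suc k := l - m)) j))"
      by (simp only:)
  qed
  also have "\<dots> = (\<Sum>ls\<in>tuples 0 (Suc k) l. of_nat (multinom (Suc k) l ls) *
      (\<Prod>j\<in>{1..Suc k}. ?A (?t j) (ls j)))"
    by (rule sum_tuples_Suc[symmetric])
  finally show ?case .
qed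

text \<open>An entry \<open>ls j = 0\<close> selects the initial value of \<open>coeffA\<close> at a
  nonzero column, which is 0, so the extra tuples contribute nothing.\<close>

lemma sum_tuples_1_eq:
  assumes nz: "\<forall>j\<in>{1..k}. \<exists>i\<in>{1..n}. s i j \<noteq> (0::nat)"
  shows "(\<Sum>ls\<in>tuples 1 k l. c ls * (\<Prod>j\<in>{1..k}. coeffA n D F (\<lambda>i. int (s i j)) (ls j))) =
    (\<Sum>ls\<in>tuples 0 k l. c ls * (\<Prod>j\<in>{1..k}. coeffA n D F (\<lambda>i. int (s i j)) (ls j)))"
proof (rule sum.mono_neutral_left)
  show "tuples 1 k l \<subseteq> tuples 0 k l"
    by (auto simp: tuples_def PiE_iff)
  show "\<forall>ls\<in>tuples 0 k l - tuples 1 k l.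
      c ls * (\<Prod>j\<in>{1..k}. coeffA n D F (\<lambda>i. int (s i j)) (ls j)) = 0"
  proof
    fix ls assume "ls \<in> tuples 0 k l - tuples 1 k l"
    then obtain j where j: "j \<in> {1..k}" "ls j = 0"
      by (force simp: tuples_def PiE_iff)
    then have "coeffA n D F (\<lambda>i. int (s i j)) (ls j) = 0"
      using nz by auto
    then show "c ls * (\<Prod>j\<in>{1..k}. coeffA n D F (\<lambda>i. int (s i j)) (ls j)) = 0"
      using j(1) by (subst prod_zero) auto
  qed
qed (rule finite_tuples)

theorem mainTheorem6:
  fixes D :: "nat \<Rightarrow> 'a::comm_ring_1 \<Rightarrow> 'a"
    and F :: "nat \<Rightarrow> 'a"
    and n k l :: nat
    and s :: "nat \<Rightarrow> nat \<Rightarrow> nat"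
  assumes "\<And>i. i \<in> {1..n} \<Longrightarrow> derivation (D i)"
    and "\<And>i i' a. i \<in> {1..n} \<Longrightarrow> i' \<in> {1..n} \<Longrightarrow> D i (D i' a) = D i' (D i a)"
  shows "((\<forall>j\<in>{1..k}. \<exists>i\<in>{1..n}. s i j \<noteq> 0) \<longrightarrow>
      of_nat (index_coeff n k s) * coeffA n D F (\<lambda>i. int (\<Sum>j\<in>{1..k}. s i j)) l =
      (\<Sum>ls\<in>tuples 1 k l. of_nat (multinom k l ls) *
         (\<Prod>j\<in>{1..k}. coeffA n D F (\<lambda>i. int (s i j)) (ls j)))) \<and>
    of_nat (index_coeff n k s) * coeffA n D F (\<lambda>i. int (\<Sum>j\<in>{1..k}. s i j)) l =
      (\<Sum>ls\<in>tuples 0 k l. of_nat (multinom k l ls) *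
         (\<Prod>j\<in>{1..k}. coeffA n D F (\<lambda>i. int (s i j)) (ls j)))"
  using coeffA_sum[of n D k s F l] assms(1)
    sum_tuples_1_eq[of k n s "\<lambda>ls. of_nat (multinom k l ls)" D F l]
  by auto

end
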